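(* Let $F$ be a finite field, let $n>1$ be an integer, and let $1\le k_1<k_2<\cdots<k_r\le n$ be integers with $1\le r\le n-1$. Put $k_{\max}=k_r$ and $G=\Gamma(M_n(F),[k_1,k_2,\ldots,k_r])$. Then $G$ is connected. Furthermore, the diameter of $G$ is attained by a pair of matrices $A,B\in M_n(F)$ for which $\operatorname{rank}(B-A)$ is the largest positive integer $k\le n$ such that $k\notin\{k_1,k_2,\ldots,k_r\}$. In particular, $$\operatorname{diam}(G)=\max\left\{2,\left\lceil \frac{n}{k_{\max}}\right\rceil\right\}.$$
   Context: For $1\le k\le n$, $V_k$ denotes the set of all matrices of rank $k$ in the ring $M_n(F)$ of $n\times n$ matrices over $F$. $\Gamma(M_n(F),[k_1,\ldots,k_r])$ denotes the graph with vertex set $M_n(F)$ in which two vertices $X,Y$ are adjacent if $X-Y\in S$, where $S=\bigsqcup_{i=1}^r V_{k_i}$. The diameter $\operatorname{diam}(G)$ is the maximum over all pairs of vertices of the graph distance $d(u,v)$ (length of a shortest path); it is attained by a pair $A,B$ if $d(A,B)=\operatorname{diam}(G)$. *)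

theory Defs
  imports
    "Jordan_Normal_Form.DL_Rank"
    "Graph_Theory.Digraph_Component"
    "Graph_Theory.Shortest_Path"
begin

definition rank_matrices :: "nat \<Rightarrow> nat \<Rightarrow> 'a::field mat set"  where
  "rank_matrices n k = {A \<in> carrier_mat n n. vec_space.rank n A = k}"

text \<open>The undirected graph on all \<open>n \<times> n\<close> matrices is encoded as a digraph whose arcs are the
  ordered pairs of adjacent matrices. As the rank is invariant under negation, the arc set is symmetric;
  it has no loops provided \<open>0\<close> is not in the list \<open>ks\<close>.\<close>

definition rank_graph :: "nat \<Rightarrow> nat list \<Rightarrow> ('a::field mat, 'a mat \<times> 'a mat) pre_digraph" where
  "rank_graph n ks =
    \<lparr> verts = carrier_mat n n,
      arcs = {(X, Y). X \<in> carrier_mat n n \<and> Y \<in> carrier_mat n n \<and>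
                X - Y \<in> (\<Union>k\<in>set ks. rank_matrices n k)},
      tail = fst,
      head = snd \<rparr>"

text \<open>Every arc has cost 1, so the cost of a walk is its length. The distance is \<open>\<infinity>\<close> between
  vertices that are not joined by a walk.\<close>

definition graph_dist :: "('v, 'e) pre_digraph \<Rightarrow> 'v \<Rightarrow> 'v \<Rightarrow> ereal" where
  "graph_dist G u v = wf_digraph.\<mu> G (\<lambda>_. 1) u v"

text \<open>For a graph with finitely many (and at least one) vertices this supremum is a maximum.\<close>

definition graph_diam :: "('v, 'e) pre_digraph \<Rightarrow> ereal" where
  "graph_diam G = (SUP u\<in>verts G. SUP v\<in>verts G. graph_dist G u v)"

end

(* Every matrix of rank m is P D Q with P, Q invertible and D the diagonal projection onto the
   first m coordinates, so whether a rank-m matrix is a sum of matrices of prescribed ranks depends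
   on m alone. Let K be the largest allowed rank. For m < K, and for K < m <= 2K, explicit models
   built from shifts show that a rank-m matrix is a sum of two matrices of rank K, over any field;
   for larger m one splits off rank-K matrices until at most 2K remains. Hence all distances are at
   most max(2, ceil(n/K)). Subadditivity of the rank gives distance >= m/K, and a nonzero matrix of
   forbidden rank has distance at least 2 from 0. The largest forbidden rank is n if K < n, so it
   attains the bound in both cases. *)

theory Submission
  imports Defs
begin

section \<open>Invertible matrices and coordinate projections\<close>

lemma det_nonzero_obtain_inverse:
  fixes P :: "'a::field mat"
  assumes "P \<in> carrier_mat n n" "det P \<noteq> 0"
  obtains Q where "Q \<in> carrier_mat n n" "det Q \<noteq> 0" "P * Q = 1\<^sub>m n" "Q * P = 1\<^sub>m n"
proof -
  from det_non_zero_imp_unit[OF assms] obtain Q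
    where Q: "Q \<in> carrier_mat n n" "P * Q = 1\<^sub>m n" "Q * P = 1\<^sub>m n"
    by (auto simp: Units_def ring_mat_def)
  moreover have "det Q \<noteq> 0"
    using det_mult[OF assms(1) Q(1)] Q(2) by auto
  ultimately show ?thesis using that by blast
qed

lemma mult_square_carrier_mat [simp]:
  "A \<in> carrier_mat n n \<Longrightarrow> B \<in> carrier_mat n n \<Longrightarrow> A * B \<in> carrier_mat n n"
  by (rule mult_carrier_mat)

lemma assoc_mult_square_mat:
  "A \<in> carrier_mat n n \<Longrightarrow> B \<in> carrier_mat n n \<Longrightarrow> C \<in> carrier_mat n n \<Longrightarrow> A * B * C = A * (B * C)"
  by (rule assoc_mult_mat)

text \<open>The projection onto the coordinates in \<open>S\<close>. Allowing any set
  \<open>S\<close> makes complements and differences of projections, and induction over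
  \<open>S\<close>, available.\<close>

definition diag_indicator :: "nat \<Rightarrow> nat set \<Rightarrow> 'a::field mat" where
  "diag_indicator n S = mat n n (\<lambda>(i, j). if i = j \<and> i \<in> S then 1 else 0)"

lemma diag_indicator_carrier [simp]: "diag_indicator n S \<in> carrier_mat n n"
  and dim_diag_indicator [simp]:
    "dim_row (diag_indicator n S) = n" "dim_col (diag_indicator n S) = n"
  by (simp_all add: diag_indicator_def)

lemma index_diag_indicator_mult:
  assumes "A \<in> carrier_mat n nc" "i < n" "j < nc"
  shows "(diag_indicator n S * A) $$ (i, j) = (if i \<in> S then A $$ (i, j) else 0)"
proof -
  have "(diag_indicator n S * A) $$ (i, j)
      = (\<Sum>k\<in>{0..<n}. (if i = k \<and> i \<in> S then 1 else 0) * A $$ (k, j))"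
    using assms by (auto simp: diag_indicator_def scalar_prod_def intro!: sum.cong)
  also have "\<dots> = (\<Sum>k\<in>{0..<n}. if k = i then (if i \<in> S then A $$ (i, j) else 0) else 0)"
    by (intro sum.cong) auto
  finally show ?thesis using assms by simp
qed

lemma diag_indicator_mult_eq:
  assumes "A \<in> carrier_mat n n"
  shows "diag_indicator n S * A = mat n n (\<lambda>(i, j). if i \<in> S then A $$ (i, j) else 0)"
  using assms by (intro eq_matI) (auto simp: index_diag_indicator_mult simp del: index_mult_mat(1))

lemma diag_indicator_diff:
  "T \<subseteq> S \<Longrightarrow> diag_indicator n S - diag_indicator n T = diag_indicator n (S - T)"
  by (rule eq_matI) (auto simp: diag_indicator_def)

text \<open>Each index \<open>k\<close> in \<open>S\<close> contributes the outer product of column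
  \<open>k\<close> of \<open>X\<close> and row \<open>k\<close> of \<open>Y\<close>, which has rank
  at most 1; subadditivity of the rank adds these up.\<close>

lemma rank_mult_diag_indicator_le:
  fixes X Y :: "'a::field mat"
  assumes X: "X \<in> carrier_mat n n" and Y: "Y \<in> carrier_mat n n" and S: "finite S"
  shows "vec_space.rank n (X * diag_indicator n S * Y) \<le> card S"
  using S
proof (induction S)
  case empty
  have "X * diag_indicator n {} * Y = 0\<^sub>m n n"
  proof -
    have "diag_indicator n {} = (0\<^sub>m n n :: 'a mat)"
      by (rule eq_matI) (auto simp: diag_indicator_def)
    then show ?thesis using X Y by simp
  qed
  then show ?case by (simp add: vec_space.rank_0I)
next
  case (insert k S)
  let ?D = "\<lambda>S. diag_indicator n S :: 'a mat"
  have split: "?D (insert k S) = ?D S + ?D {k}"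
    using insert.hyps by (intro eq_matI) (auto simp: diag_indicator_def)
  have "X * ?D (insert k S) * Y = X * ?D S * Y + X * ?D {k} * Y"
    using X Y unfolding split
    by (simp add: mult_add_distrib_mat[of _ n n _ n] add_mult_distrib_mat[of _ n n _ _ n])
  moreover have "vec_space.rank n (X * ?D {k} * Y) \<le> 1"
  proof (rule vec_space.rank_le_1_product_entries)
    show "X * ?D {k} * Y \<in> carrier_mat n n" using X Y by simp
    fix r c assume rc: "r < dim_row (X * ?D {k} * Y)" "c < dim_col (X * ?D {k} * Y)"
    have "(X * ?D {k} * Y) $$ (r, c) = (X * (?D {k} * Y)) $$ (r, c)"
      using X Y by (simp add: assoc_mult_mat[of _ n n _ n _ n])
    also have "\<dots> = (\<Sum>i<n. X $$ (r, i) * (?D {k} * Y) $$ (i, c))"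
      using X Y rc by (auto simp: scalar_prod_def lessThan_atLeast0 intro!: sum.cong)
    also have "\<dots> = (\<Sum>i<n. if i = k then X $$ (r, k) * Y $$ (k, c) else 0)"
      using Y rc by (intro sum.cong) (auto simp: index_diag_indicator_mult simp del: index_mult_mat(1))
    \<comment> \<open>For \<open>k \<ge> n\<close> no summand has \<open>i = k\<close>, hence the
      second factor 0.\<close>
    also have "\<dots> = X $$ (r, k) * (if k < n then Y $$ (k, c) else 0)" by simp
    finally show "(X * ?D {k} * Y) $$ (r, c) = X $$ (r, k) * (if k < n then Y $$ (k, c) else 0)" .
  qed
  ultimately show ?case
    using vec_space.rank_subadditive[of "X * ?D S * Y" n n "X * ?D {k} * Y"] insert X Y by fastforce
qed

text \<open>Lower bound: the same matrix for the complement of \<open>S\<close> has rank at most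
  \<open>n - card S\<close>, and the two add up to \<open>X * Y\<close>, which has full rank.\<close>

lemma rank_mult_diag_indicator:
  fixes X Y :: "'a::field mat"
  assumes X: "X \<in> carrier_mat n n" "det X \<noteq> 0" and Y: "Y \<in> carrier_mat n n" "det Y \<noteq> 0"
    and S: "S \<subseteq> {..<n}"
  shows "vec_space.rank n (X * diag_indicator n S * Y) = card S"
proof -
  let ?D = "\<lambda>S. diag_indicator n S :: 'a mat"
  have fin: "finite S" using S finite_subset by blast
  have split: "1\<^sub>m n = ?D S + ?D ({..<n} - S)"
    by (intro eq_matI) (auto simp: diag_indicator_def)
  have "X * Y = X * 1\<^sub>m n * Y" using X Y by simp
  also have "\<dots> = X * ?D S * Y + X * ?D ({..<n} - S) * Y"
    using X Y unfolding split
    by (simp add: mult_add_distrib_mat[of _ n n _ n] add_mult_distrib_mat[of _ n n _ _ n])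
  finally have XY: "X * Y = X * ?D S * Y + X * ?D ({..<n} - S) * Y" .
  have carr: "X * ?D T * Y \<in> carrier_mat n n" for T using X Y by simp
  have "vec_space.rank n (X * Y) = n"
    using X Y by (intro vec_space.low_rank_det_zero) (auto simp: det_mult)
  then have "n \<le> vec_space.rank n (X * ?D S * Y) + vec_space.rank n (X * ?D ({..<n} - S) * Y)"
    using vec_space.rank_subadditive[OF carr[of S] carr[of "{..<n} - S"]] unfolding XY by simp
  moreover have "vec_space.rank n (X * ?D ({..<n} - S) * Y) \<le> n - card S"
    using rank_mult_diag_indicator_le[OF X(1) Y(1), of "{..<n} - S"] S fin
    by (simp add: card_Diff_subset)
  moreover have "vec_space.rank n (X * ?D S * Y) \<le> card S"
    by (rule rank_mult_diag_indicator_le[OF X(1) Y(1) fin])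
  moreover have "card S \<le> n" using card_mono[OF _ S] by simp
  ultimately show ?thesis by linarith
qed

section \<open>Rank normal form and equivalence of matrices\<close>

text \<open>Gauss-Jordan elimination gives \<open>A = P * C\<close> with \<open>P\<close> invertible
  and \<open>C\<close> in reduced row echelon form. The \<open>r\<close> nonzero rows of
  \<open>C\<close> are completed to an invertible \<open>Q\<close>, so that \<open>C\<close> is a
  projection times \<open>Q\<close>; that \<open>r\<close> is the rank then follows from
  \<open>rank_mult_diag_indicator\<close>.\<close>

lemma rank_normal_form:
  fixes A :: "'a::field mat"
  assumes A: "A \<in> carrier_mat n n"
  obtains P Q where "P \<in> carrier_mat n n" "det P \<noteq> 0" "Q \<in> carrier_mat n n" "det Q \<noteq> 0"
    "A = P * diag_indicator n {..<vec_space.rank n A} * Q" "vec_space.rank n A \<le> n"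
proof -
  define C where "C = gauss_jordan_single A"
  note gj = gauss_jordan_single[OF A C_def[symmetric]]
  from gj(4) obtain P' P where P': "C = P' * A" "P' \<in> carrier_mat n n" "P \<in> carrier_mat n n"
    "P' * P = 1\<^sub>m n" "P * P' = 1\<^sub>m n" by blast
  have detP: "det P \<noteq> 0" using det_mult[OF P'(2,3)] P'(4) by auto
  have C: "C \<in> carrier_mat n n" and dimC: "dim_row C = n" "dim_col C = n" using gj(2) by auto
  have A_eq: "A = P * C"
    using P' A by (simp add: assoc_mult_mat[of P n n P' n A n, symmetric])
  from gj(3) C obtain f where f: "pivot_fun C f n" by (auto simp: row_echelon_form_def)
  note pv = pivot_funD[OF dimC(1) f]
  \<comment> \<open>A zero row has pivot index \<open>n\<close>, so \<open>r\<close> is the number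
    of nonzero rows. The value \<open>n\<close> satisfies the condition, so the least one
    exists.\<close>
  define r where "r = (LEAST r. \<not> (r < n \<and> f r < n))"
  have r: "\<not> (r < n \<and> f r < n)" unfolding r_def by (rule LeastI[of _ n]) simp
  have lt_r: "i < n \<and> f i < n" if "i < r" for i
    using not_less_Least[of i "\<lambda>r. \<not> (r < n \<and> f r < n)"] that unfolding r_def by blast
  have ge_r: "f i = n" if "r \<le> i" "i < n" for i
    using that
  proof (induction i rule: dec_induct)
    case base then show ?case using r pv(1)[of r] by auto
  next
    case (step i) then show ?case using pv(1)[of "Suc i"] pv(3)[of i] by auto
  qed
  have rn: "r \<le> n" using lt_r[of n] by (meson less_irrefl not_le)
  have inj: "inj_on f {..<r}"
  proof (rule inj_onI)
    fix i j assume *: "i \<in> {..<r}" "j \<in> {..<r}" "f i = f j"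
    then show "i = j" using lt_r[of i] lt_r[of j] pv(4)[of j] pv(5)[of j i] pv(4)[of i]
      by (metis lessThan_iff zero_neq_one)
  qed
  have img: "f ` {..<r} \<subseteq> {..<n}" using lt_r by auto
  \<comment> \<open>There are as many non-pivot columns as zero rows, so the pivot function on
    \<open>{..<r}\<close> extends to a permutation \<open>h\<close> of
    \<open>{..<n}\<close>.\<close>
  have "card {r..<n} = card ({..<n} - f ` {..<r})"
    using img inj by (simp add: card_Diff_subset card_image)
  then obtain g where g: "bij_betw g {r..<n} ({..<n} - f ` {..<r})"
    using finite_same_card_bij[of "{r..<n}" "{..<n} - f ` {..<r}"] by auto
  define h where "h i = (if i < r then f i else g i)" for i
  have "bij_betw h ({..<r} \<union> {r..<n}) (f ` {..<r} \<union> ({..<n} - f ` {..<r}))"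
  proof (rule bij_betw_combine)
    show "bij_betw h {..<r} (f ` {..<r})"
      using inj by (auto simp: bij_betw_def h_def inj_on_def)
    show "bij_betw h {r..<n} ({..<n} - f ` {..<r})"
      using g by (subst bij_betw_cong[of _ _ g]) (auto simp: h_def)
  qed auto
  moreover have "{..<r} \<union> {r..<n} = {..<n}" using rn by auto
  ultimately have h: "bij_betw h {..<n} {..<n}" using img by (simp add: Un_absorb1)
  \<comment> \<open>Complete the nonzero rows of the echelon form by unit vectors at the non-pivot columns.\<close>
  define Q where "Q = mat n n (\<lambda>(i, j). if i < r then C $$ (i, j) else if j = h i then 1 else 0)"
  have Q: "Q \<in> carrier_mat n n" by (simp add: Q_def)
  \<comment> \<open>Let \<open>v\<close> be in the kernel of \<open>Q\<close>. The unit rows make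
    \<open>v\<close> vanish at all non-pivot columns. A pivot row then reduces to its own pivot
    entry, because it is 0 in the other pivot columns, so \<open>v\<close> vanishes there
    too.\<close>
  have detQ: "det Q \<noteq> 0"
  proof
    assume "det Q = 0"
    then obtain v where v: "v \<in> carrier_vec n" "v \<noteq> 0\<^sub>v n" "Q *\<^sub>v v = 0\<^sub>v n"
      using det_0_iff_vec_prod_zero[OF Q] by auto
    have sum0: "(\<Sum>j<n. Q $$ (i, j) * v $ j) = 0" if "i < n" for i
    proof -
      have "(Q *\<^sub>v v) $ i = (\<Sum>j<n. Q $$ (i, j) * v $ j)"
        using that Q v(1) by (auto simp: scalar_prod_def lessThan_atLeast0 intro!: sum.cong)
      then show ?thesis using v(3) that by simp
    qed
    have hn: "h i < n" if "i < n" for i using h that by (auto simp: bij_betw_def)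
    have hi: "v $ h i = 0" if "r \<le> i" "i < n" for i
    proof -
      have "(\<Sum>j<n. Q $$ (i, j) * v $ j) = (\<Sum>j<n. if j = h i then v $ h i else 0)"
        using that by (intro sum.cong) (auto simp: Q_def)
      then show ?thesis using sum0[OF that(2)] hn[OF that(2)] by simp
    qed
    have lo: "v $ h i = 0" if "i < r" for i
    proof -
      have i: "i < n" using that rn by simp
      have "(\<Sum>j<n. Q $$ (i, j) * v $ j) = (\<Sum>j<n. if j = h i then v $ h i else 0)"
      proof (rule sum.cong)
        fix j assume "j \<in> {..<n}"
        then obtain k where k: "k < n" "j = h k" using h by (auto simp: bij_betw_def)
        show "Q $$ (i, j) * v $ j = (if j = h i then v $ h i else 0)"
        proof (cases "k < r")
          case False
          then have "v $ j = 0" using hi[of k] k by simp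
          then show ?thesis by auto
        next
          case True
          have "C $$ (i, f k) = (if i = k then 1 else 0)"
            using lt_r[OF True] pv(4)[of k] pv(5)[of k i] i by auto
          moreover have "f k = f i \<longleftrightarrow> k = i" using inj True that by (auto simp: inj_on_def)
          ultimately show ?thesis
            using True that i k hn[OF k(1)] by (auto simp: Q_def h_def)
        qed
      qed simp
      then show ?thesis using sum0[OF i] hn[OF i] by simp
    qed
    have "v $ j = 0" if jn: "j < n" for j
    proof -
      obtain i where "i < n" "j = h i" using h jn by (auto simp: bij_betw_def)
      then show ?thesis using hi lo by (cases "i < r") auto
    qed
    then have "v = 0\<^sub>v n" using v(1) by auto
    with v(2) show False by simp
  qed
  have "C = diag_indicator n {..<r} * Q"
  proof (rule eq_matI)
    fix i j assume "i < dim_row (diag_indicator n {..<r} * Q)" "j < dim_col (diag_indicator n {..<r} * Q)"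
    then have ij: "i < n" "j < n" using Q by auto
    show "C $$ (i, j) = (diag_indicator n {..<r} * Q) $$ (i, j)"
    proof (cases "i < r")
      case True then show ?thesis using ij unfolding diag_indicator_mult_eq[OF Q] by (simp add: Q_def)
    next
      case False
      then have "f i = n" using ge_r ij by simp
      then show ?thesis using False ij pv(2)[of i j] by (simp add: index_diag_indicator_mult[OF Q] del: index_mult_mat(1))
    qed
  qed (use C Q in auto)
  then have A_eq': "A = P * diag_indicator n {..<r} * Q"
    using A_eq assoc_mult_mat[OF P'(3) diag_indicator_carrier Q] by simp
  have rank_A: "vec_space.rank n A = r"
    using rank_mult_diag_indicator[OF P'(3) detP Q detQ, of "{..<r}"] rn A_eq' by auto
  show ?thesis
    by (rule that[OF P'(3) detP Q detQ]) (simp_all only: rank_A A_eq'[symmetric] rn)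
qed

text \<open>In the normal form of \<open>A\<close> the factors \<open>X\<close> and \<open>Y\<close>
  are absorbed into the outer factors, and \<open>rank_mult_diag_indicator_le\<close> holds for
  arbitrary outer factors.\<close>

lemma rank_mult_le:
  fixes A :: "'a::field mat"
  assumes A: "A \<in> carrier_mat n n" and X: "X \<in> carrier_mat n n" and Y: "Y \<in> carrier_mat n n"
  shows "vec_space.rank n (X * A * Y) \<le> vec_space.rank n A"
proof -
  define r where "r = vec_space.rank n A"
  obtain P Q where PQ: "P \<in> carrier_mat n n" "Q \<in> carrier_mat n n"
    and Aeq: "A = P * diag_indicator n {..<r} * Q"
    using rank_normal_form[OF A, folded r_def] by metis
  have "X * (P * diag_indicator n {..<r} * Q) * Y
      = (X * P) * diag_indicator n {..<r} * (Q * Y)"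
    by (simp only: assoc_mult_square_mat[of _ n] mult_square_carrier_mat
        diag_indicator_carrier PQ X Y)
  then have "X * A * Y = (X * P) * diag_indicator n {..<r} * (Q * Y)"
    unfolding Aeq .
  then show ?thesis
    using rank_mult_diag_indicator_le[of "X * P" n "Q * Y" "{..<r}"] PQ X Y
    unfolding r_def[symmetric] by (metis card_lessThan finite_lessThan mult_square_carrier_mat)
qed

lemma rank_mult_left_le:
  fixes A :: "'a::field mat"
  assumes "A \<in> carrier_mat n n" "X \<in> carrier_mat n n"
  shows "vec_space.rank n (X * A) \<le> vec_space.rank n A"
  using rank_mult_le[OF assms one_carrier_mat] assms by simp

lemma rank_mult_right_le:
  fixes A :: "'a::field mat"
  assumes "A \<in> carrier_mat n n" "Y \<in> carrier_mat n n"
  shows "vec_space.rank n (A * Y) \<le> vec_space.rank n A"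
  using rank_mult_le[OF assms(1) one_carrier_mat assms(2)] assms by simp

text \<open>Multiplying by the inverses recovers \<open>A\<close>, so \<open>rank_mult_le\<close>
  applies in both directions.\<close>

lemma rank_mult_det_nonzero:
  fixes A :: "'a::field mat"
  assumes A: "A \<in> carrier_mat n n" and X: "X \<in> carrier_mat n n" "det X \<noteq> 0"
    and Y: "Y \<in> carrier_mat n n" "det Y \<noteq> 0"
  shows "vec_space.rank n (X * A * Y) = vec_space.rank n A"
proof (rule antisym)
  obtain X' where X': "X' \<in> carrier_mat n n" "X' * X = 1\<^sub>m n"
    using det_nonzero_obtain_inverse[OF X] by blast
  obtain Y' where Y': "Y' \<in> carrier_mat n n" "Y * Y' = 1\<^sub>m n"
    using det_nonzero_obtain_inverse[OF Y] by blast
  have "X' * (X * A * Y) * Y' = (X' * X) * A * (Y * Y')"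
    by (simp only: assoc_mult_square_mat[of _ n] mult_square_carrier_mat
        X(1) Y(1) X'(1) Y'(1) A)
  then have "X' * (X * A * Y) * Y' = A" using X' Y' A by simp
  then show "vec_space.rank n A \<le> vec_space.rank n (X * A * Y)"
    using rank_mult_le[of "X * A * Y" n X' Y'] A X Y X' Y' by simp
qed (rule rank_mult_le[OF A X(1) Y(1)])

lemma rank_diag_indicator:
  "S \<subseteq> {..<n} \<Longrightarrow> vec_space.rank n (diag_indicator n S :: 'a::field mat) = card S"
  using rank_mult_diag_indicator[of "1\<^sub>m n" n "1\<^sub>m n :: 'a mat" S] by simp

text \<open>Both matrices have the same middle factor in their normal forms. Cancelling the outer
  factors of \<open>B\<close> and inserting those of \<open>A\<close> turns \<open>B\<close> into
  \<open>A\<close>.\<close>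

lemma rank_eq_obtain_equivalence:
  fixes A B :: "'a::field mat"
  assumes A: "A \<in> carrier_mat n n" and B: "B \<in> carrier_mat n n"
    and eq: "vec_space.rank n A = vec_space.rank n B"
  obtains X Y where "X \<in> carrier_mat n n" "det X \<noteq> 0" "Y \<in> carrier_mat n n" "det Y \<noteq> 0"
    "A = X * B * Y"
proof -
  define r where "r = vec_space.rank n A"
  have rB: "r = vec_space.rank n B" unfolding r_def by (rule eq)
  let ?D = "diag_indicator n {..<r} :: 'a mat"
  obtain P Q where P: "P \<in> carrier_mat n n" "det P \<noteq> 0" and Q: "Q \<in> carrier_mat n n" "det Q \<noteq> 0"
    and Aeq: "A = P * ?D * Q" using rank_normal_form[OF A, folded r_def] by metis
  obtain P' Q' where P': "P' \<in> carrier_mat n n" "det P' \<noteq> 0"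
    and Q': "Q' \<in> carrier_mat n n" "det Q' \<noteq> 0" and Beq: "B = P' * ?D * Q'"
    using rank_normal_form[OF B, folded rB] by metis
  obtain R where R: "R \<in> carrier_mat n n" "det R \<noteq> 0" "R * P' = 1\<^sub>m n"
    using det_nonzero_obtain_inverse[OF P'] by blast
  obtain T where T: "T \<in> carrier_mat n n" "det T \<noteq> 0" "Q' * T = 1\<^sub>m n"
    using det_nonzero_obtain_inverse[OF Q'] by blast
  have "(P * R) * (P' * ?D * Q') * (T * Q) = P * (R * P') * ?D * (Q' * T) * Q"
    by (simp only: assoc_mult_square_mat[of _ n] mult_square_carrier_mat
        diag_indicator_carrier P(1) Q(1) P'(1) Q'(1) R(1) T(1))
  then have "A = (P * R) * B * (T * Q)"
    unfolding Beq[symmetric] R(3) T(3) right_mult_one_mat[OF P(1)]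
      right_mult_one_mat[OF mult_square_carrier_mat[OF P(1) diag_indicator_carrier]] Aeq by (rule sym)
  moreover have "det (P * R) \<noteq> 0" "det (T * Q) \<noteq> 0"
    using P Q R T by (simp_all add: det_mult)
  moreover have "P * R \<in> carrier_mat n n" "T * Q \<in> carrier_mat n n"
    using P Q R T by simp_all
  ultimately show ?thesis using that by blast
qed

text \<open>Multiplication by invertible \<open>X\<close> and \<open>Y\<close> is additive and
  preserves rank, so it carries a splitting of \<open>M'\<close> to one of \<open>M\<close>. It
  therefore suffices to split one model matrix of each rank.\<close>

lemma rank_split_transfer:
  fixes M M' A' :: "'a::field mat"
  assumes M: "M \<in> carrier_mat n n" and M': "M' \<in> carrier_mat n n" and A': "A' \<in> carrier_mat n n"
    and eq: "vec_space.rank n M = vec_space.rank n M'"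
  shows "\<exists>A \<in> carrier_mat n n. vec_space.rank n A = vec_space.rank n A'
    \<and> vec_space.rank n (M - A) = vec_space.rank n (M' - A')"
proof -
  obtain X Y where X: "X \<in> carrier_mat n n" "det X \<noteq> 0" and Y: "Y \<in> carrier_mat n n" "det Y \<noteq> 0"
    and Meq: "M = X * M' * Y" using rank_eq_obtain_equivalence[OF M M' eq] by blast
  have "M - X * A' * Y = X * (M' - A') * Y"
    unfolding Meq using X Y M' A'
    by (simp add: mult_minus_distrib_mat[of _ n n _ n] minus_mult_distrib_mat[of _ n n _ _ n])
  then show ?thesis
    using rank_mult_det_nonzero[OF A' X Y] rank_mult_det_nonzero[OF minus_carrier_mat[OF A'] X Y, of M']
      A' X Y
    by (intro bexI[of _ "X * A' * Y"]) simp_all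
qed

section \<open>Splitting a matrix into two summands of prescribed rank\<close>

text \<open>With \<open>f = Suc\<close> and an interval \<open>S\<close> this is a truncated shift,
  with its ones just above the diagonal. Adding it to plus or minus the identity, or subtracting it,
  keeps the matrix invertible.\<close>

definition partial_perm_mat :: "nat \<Rightarrow> nat set \<Rightarrow> (nat \<Rightarrow> nat) \<Rightarrow> 'a::field mat" where
  "partial_perm_mat n S f = mat n n (\<lambda>(i, j). if i \<in> S \<and> j = f i then 1 else 0)"

lemma partial_perm_mat_carrier [simp]: "partial_perm_mat n S f \<in> carrier_mat n n"
  by (simp add: partial_perm_mat_def)

text \<open>The matrix \<open>M\<close> satisfies \<open>D * M = M\<close> and, by injectivity of
  \<open>f\<close>, \<open>M * transpose_mat M = D\<close> for the projection \<open>D\<close> onto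
  \<open>S\<close>. Hence neither rank exceeds the other.\<close>

lemma rank_partial_perm_mat:
  assumes S: "S \<subseteq> {..<n}" and inj: "inj_on f S" and f: "f ` S \<subseteq> {..<n}"
  shows "vec_space.rank n (partial_perm_mat n S f :: 'a::field mat) = card S"
proof (rule antisym)
  let ?M = "partial_perm_mat n S f :: 'a mat"
  have "diag_indicator n S * ?M = ?M"
    unfolding diag_indicator_mult_eq[OF partial_perm_mat_carrier]
    by (rule eq_matI) (auto simp: partial_perm_mat_def)
  then show "vec_space.rank n ?M \<le> card S"
    using rank_mult_right_le[of "diag_indicator n S" n ?M] rank_diag_indicator[OF S]
    by (metis diag_indicator_carrier partial_perm_mat_carrier)
  have "?M * transpose_mat ?M = diag_indicator n S"
  proof (rule eq_matI)
    fix i k assume "i < dim_row (diag_indicator n S)" "k < dim_col (diag_indicator n S)"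
    then have ik: "i < n" "k < n" by auto
    have "(?M * transpose_mat ?M) $$ (i, k) = (\<Sum>j<n. ?M $$ (i, j) * ?M $$ (k, j))"
      using ik by (auto simp: partial_perm_mat_def scalar_prod_def lessThan_atLeast0 intro!: sum.cong)
    also have "\<dots> = (\<Sum>j<n. if j = f i then (if i = k \<and> i \<in> S then 1 else 0) else 0)"
      using ik inj by (intro sum.cong) (auto simp: partial_perm_mat_def inj_on_def)
    also have "\<dots> = (if i = k \<and> i \<in> S then 1 else 0)"
      using f by auto
    finally show "(?M * transpose_mat ?M) $$ (i, k) = diag_indicator n S $$ (i, k)"
      using ik by (simp add: diag_indicator_def)
  qed (simp_all add: partial_perm_mat_def)
  then show "card S \<le> vec_space.rank n ?M"
    using rank_mult_right_le[of ?M n "transpose_mat ?M"] rank_diag_indicator[OF S]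
    by (metis partial_perm_mat_carrier transpose_carrier_mat)
qed

lemma det_upper_triangular_nonzero:
  fixes A :: "'a::field mat"
  assumes "A \<in> carrier_mat n n" "\<And>i j. j < i \<Longrightarrow> i < n \<Longrightarrow> A $$ (i, j) = 0"
    "\<And>i. i < n \<Longrightarrow> A $$ (i, i) \<noteq> 0"
  shows "det A \<noteq> 0"
  using det_upper_triangular[of A n] assms
  by (auto simp: upper_triangular_def prod_list_zero_iff diag_mat_def)

text \<open>Model: a truncated shift \<open>N\<close> of rank \<open>m\<close>, which exists since \<open>m < n\<close>, and the projection
  \<open>D\<close> of rank \<open>k\<close>. Because \<open>m < k\<close>, \<open>N - D = D * (N - 1)\<close> with \<open>N - 1\<close> invertible.\<close>

lemma rank_split_small:
  fixes M :: "'a::field mat"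
  assumes M: "M \<in> carrier_mat n n" and m: "vec_space.rank n M < k" and k: "k \<le> n"
  shows "\<exists>A \<in> carrier_mat n n. vec_space.rank n A = k \<and> vec_space.rank n (M - A) = k"
proof -
  define m where "m = vec_space.rank n M"
  have mk: "m < k" using m m_def by simp
  let ?N = "partial_perm_mat n {..<m} Suc :: 'a mat"
  let ?U = "?N - 1\<^sub>m n"
  have U: "?U \<in> carrier_mat n n" by (intro minus_carrier_mat) simp
  have rM: "vec_space.rank n M = vec_space.rank n ?N"
    using mk k unfolding m_def[symmetric] by (subst rank_partial_perm_mat) auto
  have "?N - diag_indicator n {..<k} = diag_indicator n {..<k} * ?U"
    unfolding diag_indicator_mult_eq[OF U] using mk
    by (intro eq_matI) (auto simp: partial_perm_mat_def diag_indicator_def)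
  \<comment> \<open>\<open>?U\<close> is upper triangular with -1 on the diagonal. The left factor
    \<open>1\<^sub>m n\<close> only gives the product the shape of the rank formula.\<close>
  moreover have "vec_space.rank n (1\<^sub>m n * diag_indicator n {..<k} * ?U) = card {..<k}"
    using k by (intro rank_mult_diag_indicator det_upper_triangular_nonzero)
      (auto simp: partial_perm_mat_def)
  ultimately have rB: "vec_space.rank n (?N - diag_indicator n {..<k}) = k" by simp
  have rA: "vec_space.rank n (diag_indicator n {..<k} :: 'a mat) = k"
    using k by (simp add: rank_diag_indicator)
  from rank_split_transfer[OF M partial_perm_mat_carrier diag_indicator_carrier rM, of "{..<k}"]
  show ?thesis unfolding rA rB .
qed

text \<open>Model: the projection of rank \<open>m = k + s\<close>. Its part of rank \<open>k\<close> is perturbed by a truncated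
  shift of rank \<open>k - s\<close>, so that the complement, initially of rank \<open>s\<close>, also reaches rank \<open>k\<close>.\<close>

lemma rank_split_large:
  fixes M :: "'a::field mat"
  assumes M: "M \<in> carrier_mat n n" and m: "k < vec_space.rank n M" "vec_space.rank n M \<le> 2 * k"
  shows "\<exists>A \<in> carrier_mat n n. vec_space.rank n A = k \<and> vec_space.rank n (M - A) = k"
proof -
  define m where "m = vec_space.rank n M"
  define s where "s = m - k"
  have s: "m = k + s" "1 \<le> s" "s \<le> k" using m m_def s_def by auto
  have mn: "m \<le> n" unfolding m_def by (rule rank_normal_form[OF M])
  \<comment> \<open>The interval has \<open>k - s\<close> rows, and their columns
    \<open>Suc i\<close> fill \<open>{s..<k}\<close>. These avoid \<open>{k..<m}\<close>, so the
    complement \<open>?B\<close>, the sum of \<open>?N\<close> and the projection onto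
    \<open>{k..<m}\<close>, is again a partial permutation, of rank
    \<open>(k - s) + s = k\<close>.\<close>
  let ?N = "partial_perm_mat n {s - 1..<k - 1} Suc :: 'a mat"
  let ?A = "diag_indicator n {..<k} * (1\<^sub>m n - ?N)"
  let ?B = "partial_perm_mat n ({s - 1..<k - 1} \<union> {k..<m}) (\<lambda>i. if i < k then Suc i else i) :: 'a mat"
  have U: "1\<^sub>m n - ?N \<in> carrier_mat n n" by (intro minus_carrier_mat) simp
  have A: "?A \<in> carrier_mat n n" using U by simp
  have "vec_space.rank n (1\<^sub>m n * diag_indicator n {..<k} * (1\<^sub>m n - ?N)) = card {..<k}"
    using mn s by (intro rank_mult_diag_indicator det_upper_triangular_nonzero)
      (auto simp: partial_perm_mat_def)
  then have rA: "vec_space.rank n ?A = k" by simp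
  have "diag_indicator n {..<m} - ?A = ?B"
    unfolding diag_indicator_mult_eq[OF U] using s
    by (intro eq_matI) (auto simp: partial_perm_mat_def diag_indicator_def)
  moreover have "vec_space.rank n ?B = card ({s - 1..<k - 1} \<union> {k..<m})"
    using s mn by (intro rank_partial_perm_mat) (auto simp: inj_on_def)
  moreover have "card ({s - 1..<k - 1} \<union> {k..<m}) = k"
    using s by (subst card_Un_disjoint) auto
  ultimately have rB: "vec_space.rank n (diag_indicator n {..<m} - ?A) = k" by simp
  have rM: "vec_space.rank n M = vec_space.rank n (diag_indicator n {..<m} :: 'a mat)"
    using mn by (simp add: rank_diag_indicator m_def)
  from rank_split_transfer[OF M diag_indicator_carrier A rM]
  show ?thesis unfolding rA rB .
qed

text \<open>In the model of nested projections, the difference is the projection onto the remaining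
  coordinates.\<close>

lemma rank_split_diff:
  fixes M :: "'a::field mat"
  assumes M: "M \<in> carrier_mat n n" and m: "k \<le> vec_space.rank n M"
  shows "\<exists>A \<in> carrier_mat n n. vec_space.rank n A = k \<and> vec_space.rank n (M - A) = vec_space.rank n M - k"
proof -
  define m where "m = vec_space.rank n M"
  have mn: "m \<le> n" unfolding m_def by (rule rank_normal_form[OF M])
  have rM: "vec_space.rank n M = vec_space.rank n (diag_indicator n {..<m} :: 'a mat)"
    using mn by (simp add: rank_diag_indicator m_def)
  have rB: "vec_space.rank n (diag_indicator n {..<m} - diag_indicator n {..<k} :: 'a mat) = m - k"
    using m mn unfolding m_def[symmetric]
    by (subst diag_indicator_diff, simp, subst rank_diag_indicator) (auto simp: card_Diff_subset)
  have rA: "vec_space.rank n (diag_indicator n {..<k} :: 'a mat) = k"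
    using m mn m_def by (simp add: rank_diag_indicator)
  from rank_split_transfer[OF M diag_indicator_carrier diag_indicator_carrier rM, of "{..<k}"]
  show ?thesis unfolding rA rB unfolding m_def .
qed

lemma rank_uminus:
  fixes A :: "'a::field mat"
  assumes A: "A \<in> carrier_mat n n"
  shows "vec_space.rank n (- A) = vec_space.rank n A"
proof -
  have le: "vec_space.rank n (- B) \<le> vec_space.rank n B" if B: "B \<in> carrier_mat n n" for B :: "'a mat"
  proof -
    have "- B = (- 1\<^sub>m n) * B" using B by (simp add: uminus_mult_left_mat[symmetric])
    then show ?thesis using rank_mult_left_le[OF B, of "- 1\<^sub>m n"] by simp
  qed
  have "- (- A) = A" by (rule eq_matI) auto
  then show ?thesis using le[OF A] le[of "- A"] A by auto
qed

section \<open>Walks in the rank graph\<close>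

lemma wf_rank_graph: "wf_digraph (rank_graph n ks)"
  by unfold_locales (auto simp: rank_graph_def)

lemma verts_rank_graph [simp]: "verts (rank_graph n ks) = carrier_mat n n"
  and tail_rank_graph [simp]: "tail (rank_graph n ks) = fst"
  and head_rank_graph [simp]: "head (rank_graph n ks) = snd"
  by (simp_all add: rank_graph_def)

lemma arcs_rank_graph_iff:
  "(X, Y) \<in> arcs (rank_graph n ks) \<longleftrightarrow> X \<in> carrier_mat n n \<and> Y \<in> carrier_mat n n
    \<and> vec_space.rank n (X - Y) \<in> set ks"
  by (auto simp: rank_graph_def rank_matrices_def)

text \<open>\<open>X - Y\<close> is the sum of the differences along the arcs, each of rank at most
  \<open>K\<close>, and the rank is subadditive.\<close>

lemma rank_diff_le_awalk_length:
  assumes "pre_digraph.awalk (rank_graph n ks) X p Y" and "\<And>k. k \<in> set ks \<Longrightarrow> k \<le> K"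
  shows "vec_space.rank n (X - Y) \<le> length p * K"
  using assms(1)
proof (induction p arbitrary: X)
  case Nil
  then have "X \<in> carrier_mat n n" "Y = X"
    by (auto simp: pre_digraph.awalk_def wf_digraph.awalk_Nil_iff[OF wf_rank_graph] pre_digraph.cas.simps)
  then show ?case by (simp add: vec_space.rank_0I)
next
  case (Cons e p)
  obtain Z where e: "e = (X, Z)" "(X, Z) \<in> arcs (rank_graph n ks)"
    and p: "pre_digraph.awalk (rank_graph n ks) Z p Y"
    using Cons.prems by (cases e) (auto simp: wf_digraph.awalk_Cons_iff[OF wf_rank_graph])
  have XZ: "X \<in> carrier_mat n n" "Z \<in> carrier_mat n n" "vec_space.rank n (X - Z) \<in> set ks"
    using e(2) by (simp_all add: arcs_rank_graph_iff)
  have Y: "Y \<in> carrier_mat n n"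
    using wf_digraph.awalk_last_in_verts[OF wf_rank_graph p] by simp
  have "X - Y = (X - Z) + (Z - Y)" using XZ Y by (intro eq_matI) auto
  then have "vec_space.rank n (X - Y) \<le> vec_space.rank n (X - Z) + vec_space.rank n (Z - Y)"
    using vec_space.rank_subadditive[OF minus_carrier_mat[OF XZ(2)] minus_carrier_mat[OF Y]] by metis
  also have "\<dots> \<le> K + length p * K"
    by (rule add_mono[OF assms(2)[OF XZ(3)] Cons.IH[OF p]])
  finally show ?case by simp
qed

text \<open>Translates splitting off a matrix \<open>A\<close> of allowed rank into one more arc at
  the front of a walk.\<close>

lemma awalk_rank_graph_step:
  assumes "pre_digraph.awalk (rank_graph n ks) (X - A) p Y"
    and "X \<in> carrier_mat n n" "A \<in> carrier_mat n n" "vec_space.rank n A \<in> set ks"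
  shows "pre_digraph.awalk (rank_graph n ks) X ((X, X - A) # p) Y"
proof -
  have "X - (X - A) = A" using assms(2,3) by (intro eq_matI) auto
  then show ?thesis using assms
    by (simp add: wf_digraph.awalk_Cons_iff[OF wf_rank_graph] arcs_rank_graph_iff minus_carrier_mat)
qed

text \<open>Arcs of rank \<open>K\<close> suffice. The induction starts at \<open>t = 2\<close>,
  where a difference of rank other than \<open>K\<close> is split into two matrices of rank
  \<open>K\<close>; each further arc lowers the rank of the difference by \<open>K\<close> when it
  exceeds the bound for \<open>t\<close>.\<close>

lemma exists_short_awalk:
  fixes X Y :: "'a::field mat"
  assumes K: "K \<in> set ks" "K \<le> n" and t: "2 \<le> t"
    and "X \<in> carrier_mat n n" and Y: "Y \<in> carrier_mat n n"
    and "vec_space.rank n (X - Y) \<le> t * K"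
  shows "\<exists>p. pre_digraph.awalk (rank_graph n ks) X p Y \<and> length p \<le> t"
  using t assms(4,6)
proof (induction t arbitrary: X rule: nat_induct_at_least)
  case base
  let ?M = "X - Y"
  have X: "X \<in> carrier_mat n n" and M: "?M \<in> carrier_mat n n" using base Y by (auto intro: minus_carrier_mat)
  have nil: "pre_digraph.awalk (rank_graph n ks) Y [] Y"
    using Y by (simp add: wf_digraph.awalk_Nil_iff[OF wf_rank_graph])
  have XMY: "X - ?M = Y" using X Y by (intro eq_matI) auto
  show ?case
  proof (cases "vec_space.rank n ?M = K")
    case True
    then show ?thesis
      using awalk_rank_graph_step[of n ks X ?M "[]" Y] nil X M K XMY by force
  next
    case False
    then obtain A where A: "A \<in> carrier_mat n n" "vec_space.rank n A = K" "vec_space.rank n (?M - A) = K"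
      using rank_split_small[OF M _ K(2)] rank_split_large[OF M, of K] base(2)
      by (metis nat_neq_iff)
    have "X - A - (?M - A) = Y" using X Y A(1) by (intro eq_matI) auto
    then have "pre_digraph.awalk (rank_graph n ks) (X - A) [(X - A, Y)] Y"
      using awalk_rank_graph_step[of n ks "X - A" "?M - A" "[]" Y] nil A K(1) M by (simp add: minus_carrier_mat)
    from awalk_rank_graph_step[OF this X A(1)] show ?thesis
      using A(2) K(1) by force
  qed
next
  case (Suc t)
  let ?M = "X - Y"
  have X: "X \<in> carrier_mat n n" and M: "?M \<in> carrier_mat n n" using Suc Y by (auto intro: minus_carrier_mat)
  show ?case
  proof (cases "vec_space.rank n ?M \<le> t * K")
    case True
    then show ?thesis using Suc.IH[OF X] le_SucI by blast
  next
    case False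
    \<comment> \<open>Since \<open>t \<ge> 2\<close>, a rank above \<open>t * K\<close> is at least
      \<open>K\<close>, so a matrix of rank \<open>K\<close> can be split off.\<close>
    moreover have "K \<le> t * K" using Suc.hyps by (cases t) auto
    ultimately have "K \<le> vec_space.rank n ?M" by linarith
    then obtain A where A: "A \<in> carrier_mat n n" "vec_space.rank n A = K"
      "vec_space.rank n (?M - A) = vec_space.rank n ?M - K"
      using rank_split_diff[OF M] by blast
    have "X - A - Y = ?M - A" using X Y A(1) by (intro eq_matI) auto
    then have "vec_space.rank n (X - A - Y) \<le> t * K" using A(3) Suc.prems(2) by simp
    then obtain p where p: "pre_digraph.awalk (rank_graph n ks) (X - A) p Y" "length p \<le> t"
      using Suc.IH[OF minus_carrier_mat[OF A(1)]] by blast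
    show ?thesis
      using awalk_rank_graph_step[OF p(1) X A(1)] A(2) K(1) p(2) by force
  qed
qed

section \<open>Distances and lengths of walks\<close>

context wf_digraph
begin

lemma awalk_cost_const_1: "awalk_cost (\<lambda>_. 1) p = real (length p)"
  by (induction p) simp_all

lemma graph_dist_le_length:
  "awalk u p v \<Longrightarrow> graph_dist G u v \<le> ereal (real (length p))"
  using min_cost_le_walk_cost[of u p v "\<lambda>_. 1"]
  by (simp add: graph_dist_def awalk_cost_const_1)

text \<open>The distance is an infimum over walks. If there is no walk, it is \<infinity> and the
  bound is trivial.\<close>

lemma graph_dist_geI:
  "(\<And>p. awalk u p v \<Longrightarrow> d \<le> length p) \<Longrightarrow> ereal (real d) \<le> graph_dist G u v"
  unfolding graph_dist_def \<mu>_def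
  by (intro INF_greatest) (auto simp: awalk_cost_const_1)

end

section \<open>Connectedness and diameter\<close>

theorem theorem3p14:
  fixes n :: nat and ks :: "nat list"
    and G :: "('a::{field,finite} mat, 'a mat \<times> 'a mat) pre_digraph"
  assumes "n > 1"
    and "sorted_wrt (<) ks"
    and "\<forall>k\<in>set ks. 1 \<le> k \<and> k \<le> n"
    and "1 \<le> length ks" and "length ks \<le> n - 1"
    and "G = rank_graph n ks"
  shows "Digraph_Component.connected G
    \<and> (\<exists>A\<in>carrier_mat n n. \<exists>B\<in>carrier_mat n n.
         graph_dist G A B = graph_diam G
         \<and> vec_space.rank n (B - A) = Max {k. 1 \<le> k \<and> k \<le> n \<and> k \<notin> set ks})
    \<and> graph_diam G = ereal (real_of_int (max 2 \<lceil>real n / real (last ks)\<rceil>))"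
proof -
  have wf: "wf_digraph G" and vG: "verts G = carrier_mat n n"
    using assms(6) wf_rank_graph by auto
  define K where "K = last ks"
  define T where "T = max 2 (nat \<lceil>real n / real K\<rceil>)"
  define m where "m = Max {k. 1 \<le> k \<and> k \<le> n \<and> k \<notin> set ks}"
  have ne: "ks \<noteq> []" using assms(4) by auto
  have K: "K \<in> set ks" "1 \<le> K" "K \<le> n"
    using ne assms(3) by (auto simp: K_def)
  have K_max: "k \<le> K" if "k \<in> set ks" for k
  proof -
    have "ks = butlast ks @ [K]" using ne by (simp add: K_def)
    then show ?thesis using that assms(2)
      by (metis Un_iff empty_iff empty_set le_less list.set_intros(1) set_ConsD set_append sorted_wrt_append)
  qed
  have T: "real_of_int (max 2 \<lceil>real n / real (last ks)\<rceil>) = real T"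
    unfolding T_def K_def by linarith
  have "real n / real K \<le> real T" unfolding T_def by linarith
  then have nT: "n \<le> T * K"
    using K(2) by (simp add: divide_le_eq flip: of_nat_mult)
  have short: "\<exists>p. pre_digraph.awalk G X p Y \<and> length p \<le> T"
    if "X \<in> carrier_mat n n" "Y \<in> carrier_mat n n" for X Y
  proof -
    have "vec_space.rank n (X - Y) \<le> n"
      by (rule vec_space.rank_le_nc[OF minus_carrier_mat[OF that(2)]])
    then show ?thesis
      using exists_short_awalk[OF K(1,3) _ that, of T] nT unfolding assms(6) by (simp add: T_def)
  qed
  \<comment> \<open>At most \<open>n - 1\<close> ranks are allowed, so some rank in
    \<open>{1..n}\<close> is forbidden and the maximum \<open>m\<close> is taken over a nonempty
    set.\<close>
  have "card (set ks) < card {1..n}"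
    using card_length[of ks] assms(1,5) by simp
  then have "{k. 1 \<le> k \<and> k \<le> n \<and> k \<notin> set ks} \<noteq> {}"
    using card_mono[of "set ks" "{1..n}"] by fastforce
  then have "m \<in> {k. 1 \<le> k \<and> k \<le> n \<and> k \<notin> set ks}"
    unfolding m_def by (intro Max_in) auto
  then have m: "1 \<le> m" "m \<le> n" "m \<notin> set ks" by auto
  have m_eq: "m = n" if "K < n"
  proof -
    have "n \<notin> set ks" using K_max that by fastforce
    then have "n \<le> m" unfolding m_def using assms(1) by (intro Max_ge) auto
    then show ?thesis using m(2) by simp
  qed
  \<comment> \<open>The extremal pair is a projection of rank \<open>m\<close> and the zero matrix.
    Arcs use the difference \<open>?A - ?O\<close>, the claim uses \<open>?O - ?A\<close>, so both
    ranks are computed.\<close>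
  let ?A = "diag_indicator n {..<m} :: 'a mat"
  let ?O = "0\<^sub>m n n :: 'a mat"
  have "?A - ?O = ?A" by (rule eq_matI) auto
  then have rA: "vec_space.rank n (?A - ?O) = m"
    using m(2) by (simp add: rank_diag_indicator)
  have "?O - ?A = - ?A" by (rule eq_matI) auto
  then have rB: "vec_space.rank n (?O - ?A) = m"
    using m(2) by (simp add: rank_uminus rank_diag_indicator)
  \<comment> \<open>Length 0 is excluded by \<open>m \<ge> 1\<close> and length 1 because
    \<open>m\<close> is forbidden. If \<open>K < n\<close>, then \<open>m = n\<close> and the rank
    bound gives the ceiling; if \<open>K = n\<close>, the ceiling is 1.\<close>
  have lower: "T \<le> length p" if p: "pre_digraph.awalk G ?A p ?O" for p
  proof -
    have le: "m \<le> length p * k" if "\<And>j. j \<in> set ks \<Longrightarrow> j \<le> k" for k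
      using rank_diff_le_awalk_length[OF p[unfolded assms(6)] that] rA by simp
    have "p \<noteq> []" using le[OF K_max] m(1) by auto
    moreover have "p \<noteq> [e]" for e
      using p rA m(3) unfolding assms(6)
      by (cases e) (auto simp: wf_digraph.awalk_Cons_iff[OF wf_rank_graph]
          wf_digraph.awalk_Nil_iff[OF wf_rank_graph] arcs_rank_graph_iff)
    ultimately have two: "2 \<le> length p"
      by (cases p; cases "tl p") auto
    moreover have "\<lceil>real n / real K\<rceil> \<le> int (length p)"
    proof (cases "K < n")
      case True
      then have "n \<le> length p * K" using m_eq le[OF K_max] by simp
      then have "real n \<le> real (length p) * real K" by (simp flip: of_nat_mult)
      then show ?thesis using K(2) by (simp add: ceiling_le_iff divide_le_eq)
    next
      case False
      then show ?thesis using K assms(1) two by simp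
    qed
    ultimately show ?thesis unfolding T_def by linarith
  qed
  have upper: "graph_dist G X Y \<le> ereal (real T)"
    if "X \<in> carrier_mat n n" "Y \<in> carrier_mat n n" for X Y
  proof -
    from short[OF that] obtain p where "pre_digraph.awalk G X p Y" "length p \<le> T" by blast
    then show ?thesis using wf_digraph.graph_dist_le_length[OF wf, of X p Y]
      by (meson ereal_less_eq(3) of_nat_le_iff order_trans)
  qed
  have dist: "graph_dist G ?A ?O = ereal (real T)"
    by (intro antisym upper wf_digraph.graph_dist_geI wf lower) auto
  have diam: "graph_diam G = ereal (real T)"
  proof (rule antisym)
    show "graph_diam G \<le> ereal (real T)"
      unfolding graph_diam_def vG by (intro SUP_least upper)
    show "ereal (real T) \<le> graph_diam G"
      unfolding graph_diam_def vG dist[symmetric]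
      by (rule SUP_upper2[of ?A], simp, rule SUP_upper2[of ?O]) simp_all
  qed
  \<comment> \<open>Connectedness means strong connectedness of the symmetric closure, and any two
    vertices are already joined by a walk in \<open>G\<close>.\<close>
  have "Digraph_Component.connected G"
    unfolding connected_def
  proof (rule strongly_connectedI)
    show "verts (mk_symmetric G) \<noteq> {}" using vG zero_carrier_mat by auto
    fix X Y assume "X \<in> verts (mk_symmetric G)" "Y \<in> verts (mk_symmetric G)"
    then have "X \<rightarrow>\<^sup>*\<^bsub>G\<^esub> Y"
      using short[of X Y] wf_digraph.reachable_awalk[OF wf] vG by auto
    then show "X \<rightarrow>\<^sup>*\<^bsub>with_proj (mk_symmetric G)\<^esub> Y"
      using wf_digraph.reachable_mk_symmetricI[OF wf] by blast
  qed
  then show ?thesis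
    using dist diam rB m_def T by (metis diag_indicator_carrier zero_carrier_mat)
qed

end
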